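(* For every $1\le p\le\infty$, the space $\mathcal D_p(\mathbb R^2,\Delta)$ has infinite asymptotic dimension.
   Context: $\mathbb R^2$ carries the Euclidean metric and $\Delta=\{(x,y)\in\mathbb R^2:x=y\}$. Persistence diagrams on a metric space $(X,d)$ relative to a non-empty closed subset $A$: for a set $Y$, let $\widetilde{\mathcal D}(Y)$ be the set of countable (finite or countably infinite) multisets of elements of $Y$; the sum of two multisets is their disjoint union. For $\widetilde\sigma,\widetilde\tau\in\widetilde{\mathcal D}(X)$ put $\widetilde d_p(\widetilde\sigma,\widetilde\tau)=\inf_\phi\big(\sum_{x\in\widetilde\sigma}d(x,\phi(x))^p\big)^{1/p}$ if $p<\infty$ and $\widetilde d_\infty(\widetilde\sigma,\widetilde\tau)=\inf_\phi\sup_{x\in\widetilde\sigma}d(x,\phi(x))$, over all bijections $\phi\colon\widetilde\sigma\to\widetilde\tau$ of multisets ($\inf\varnothing=\infty$). Write $\widetilde\sigma\sim_A\widetilde\tau$ if $\widetilde\sigma+\widetilde\alpha=\widetilde\tau+\widetilde\beta$ for some $\widetilde\alpha,\widetilde\beta\in\widetilde{\mathcal D}(A)$; let $\mathcal D(X,A)=\widetilde{\mathcal D}(X)/\!\sim_A$, with $\sigma$ the class of $\widetilde\sigma$ and $\sigma_\varnothing$ the class of the empty multiset. Put $d_p(\sigma,\tau)=\inf_{\widetilde\alpha,\widetilde\beta\in\widetilde{\mathcal D}(A)}\widetilde d_p(\widetilde\sigma+\widetilde\alpha,\widetilde\tau+\widetilde\beta)$ and $\mathcal D_p(X,A)=\{\sigma: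 d_p(\sigma,\sigma_\varnothing)<\infty\}$ with $d_p$ (a metric for $p<\infty$, a pseudometric for $p=\infty$). The asymptotic dimension of a (pseudo)metric space $M$ is the least non-negative integer $m$ such that for every $R>0$ there is a cover of $M$ by sets of uniformly bounded diameter such that every ball of radius $R$ meets at most $m+1$ members; it is $\infty$ if no such integer exists. *)

theory Defs
  imports "HOL-Analysis.Analysis" "HOL-Library.Extended_Nat"
begin

section \<open>Countable multisets and matchings\<close>

text \<open>
  A countable multiset is represented by its multiplicity function.  Multiplicities lie in
  \<^typ>\<open>enat\<close>, since a countably infinite multiset may repeat a single point infinitely often.
\<close>

definition cmsets :: "'a set \<Rightarrow> ('a \<Rightarrow> enat) set" where
  "cmsets Y = {\<sigma>. countable {x. \<sigma> x \<noteq> 0} \<and> {x. \<sigma> x \<noteq> 0} \<subseteq> Y}"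

definition empty_cmset :: "'a \<Rightarrow> enat" where
  "empty_cmset = (\<lambda>x. 0)"

definition cmset_add :: "('a \<Rightarrow> enat) \<Rightarrow> ('a \<Rightarrow> enat) \<Rightarrow> 'a \<Rightarrow> enat" (infixl "+\<^sub>m" 65) where
  "\<sigma> +\<^sub>m \<tau> = (\<lambda>x. \<sigma> x + \<tau> x)"

text \<open>
  The individual elements of a multiset: a point of multiplicity \<open>n\<close> contributes \<open>n\<close> labelled
  copies.  Bijections of multisets are bijections between these sets.
\<close>

definition elts :: "('a \<Rightarrow> enat) \<Rightarrow> ('a \<times> nat) set" where
  "elts \<sigma> = {(x, i). enat i < \<sigma> x}"

text \<open>Powers of extended non-negative reals, meant for positive exponents.\<close>

definition ennpowr :: "ennreal \<Rightarrow> real \<Rightarrow> ennreal" where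
  "ennpowr x r = (if x = \<infinity> then \<infinity> else ennreal (enn2real x powr r))"

definition lp_total :: "ennreal \<Rightarrow> ('i \<Rightarrow> real) \<Rightarrow> 'i set \<Rightarrow> ennreal" where
  "lp_total p f I =
     (if p = \<infinity> then SUP i\<in>I. ennreal (f i)
      else ennpowr (\<Sum>\<^sub>\<infinity>i\<in>I. ennreal (f i powr enn2real p)) (1 / enn2real p))"

definition matching_dist ::
    "ennreal \<Rightarrow> ('a::metric_space \<Rightarrow> enat) \<Rightarrow> ('a \<Rightarrow> enat) \<Rightarrow> ennreal" where
  "matching_dist p \<sigma> \<tau> =
     (INF \<phi>\<in>{\<phi>. bij_betw \<phi> (elts \<sigma>) (elts \<tau>)}.
        lp_total p (\<lambda>z. dist (fst z) (fst (\<phi> z))) (elts \<sigma>))"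


section \<open>Persistence diagrams\<close>

definition dgm_rel :: "'a set \<Rightarrow> 'a set \<Rightarrow> (('a \<Rightarrow> enat) \<times> ('a \<Rightarrow> enat)) set" where
  "dgm_rel X A = {(\<sigma>, \<tau>). \<sigma> \<in> cmsets X \<and> \<tau> \<in> cmsets X \<and>
     (\<exists>\<alpha>\<in>cmsets A. \<exists>\<beta>\<in>cmsets A. \<sigma> +\<^sub>m \<alpha> = \<tau> +\<^sub>m \<beta>)}"

definition diagrams :: "'a set \<Rightarrow> 'a set \<Rightarrow> ('a \<Rightarrow> enat) set set" where
  "diagrams X A = cmsets X // dgm_rel X A"

definition empty_dgm :: "'a set \<Rightarrow> 'a set \<Rightarrow> ('a \<Rightarrow> enat) set" where
  "empty_dgm X A = dgm_rel X A `` {empty_cmset}"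

definition rep_dist ::
    "ennreal \<Rightarrow> 'a::metric_space set \<Rightarrow> ('a \<Rightarrow> enat) \<Rightarrow> ('a \<Rightarrow> enat) \<Rightarrow> ennreal" where
  "rep_dist p A \<sigma> \<tau> =
     (INF \<alpha>\<in>cmsets A. INF \<beta>\<in>cmsets A. matching_dist p (\<sigma> +\<^sub>m \<alpha>) (\<tau> +\<^sub>m \<beta>))"

text \<open>
  On classes, the infimum over representatives is only a way to pass to the quotient:
  \<^term>\<open>rep_dist p A\<close> does not depend on the representatives, see \<open>dgm_dist_class\<close> below.
\<close>

definition dgm_dist ::
    "ennreal \<Rightarrow> 'a::metric_space set \<Rightarrow> ('a \<Rightarrow> enat) set \<Rightarrow> ('a \<Rightarrow> enat) set \<Rightarrow> ennreal" where
  "dgm_dist p A S T = (INF \<sigma>\<in>S. INF \<tau>\<in>T. rep_dist p A \<sigma> \<tau>)"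

definition dgm_space ::
    "ennreal \<Rightarrow> 'a::metric_space set \<Rightarrow> 'a set \<Rightarrow> ('a \<Rightarrow> enat) set set" where
  "dgm_space p X A = {S \<in> diagrams X A. dgm_dist p A S (empty_dgm X A) < \<infinity>}"

definition diagonal :: "(real \<times> real) set" where
  "diagonal = {(x, y). x = y}"


section \<open>Asymptotic dimension of a pseudometric space\<close>

definition asdim_at_most :: "'b set \<Rightarrow> ('b \<Rightarrow> 'b \<Rightarrow> ennreal) \<Rightarrow> nat \<Rightarrow> bool" where
  "asdim_at_most M d m \<longleftrightarrow>
     (\<forall>R::real. R > 0 \<longrightarrow>
        (\<exists>\<U>. \<Union>\<U> = M \<and>
             (\<exists>D::real. \<forall>U\<in>\<U>. \<forall>x\<in>U. \<forall>y\<in>U. d x y \<le> ennreal D) \<and>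
             (\<forall>x\<in>M. finite {U\<in>\<U>. U \<inter> {y\<in>M. d x y < ennreal R} \<noteq> {}} \<and>
                    card {U\<in>\<U>. U \<inter> {y\<in>M. d x y < ennreal R} \<noteq> {}} \<le> m + 1)))"

definition asdim :: "'b set \<Rightarrow> ('b \<Rightarrow> 'b \<Rightarrow> ennreal) \<Rightarrow> enat" where
  "asdim M d = (INF m\<in>{m. asdim_at_most M d m}. enat m)"


section \<open>Well-definedness on the quotient\<close>

lemma cmset_add_ac:
  "(a +\<^sub>m b) +\<^sub>m c = a +\<^sub>m (b +\<^sub>m c)" "a +\<^sub>m b = b +\<^sub>m a" "a +\<^sub>m (b +\<^sub>m c) = b +\<^sub>m (a +\<^sub>m c)"
  by (simp_all add: cmset_add_def fun_eq_iff ac_simps)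

lemma cmsets_add: "a \<in> cmsets Y \<Longrightarrow> b \<in> cmsets Y \<Longrightarrow> a +\<^sub>m b \<in> cmsets Y"
  unfolding cmsets_def cmset_add_def
  by (auto intro: countable_subset[of _ "{x. a x \<noteq> 0} \<union> {x. b x \<noteq> 0}"])

lemma empty_cmset_in: "empty_cmset \<in> cmsets Y"
  by (simp add: cmsets_def empty_cmset_def)

lemma equiv_dgm_rel: "equiv (cmsets X) (dgm_rel X A)"
proof (rule equivI)
  show "dgm_rel X A \<subseteq> cmsets X \<times> cmsets X" by (auto simp: dgm_rel_def)
  show "refl_on (cmsets X) (dgm_rel X A)"
    using empty_cmset_in by (force simp: refl_on_def dgm_rel_def)
  show "sym (dgm_rel X A)"
    unfolding sym_def dgm_rel_def by (auto intro: sym)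
  show "trans (dgm_rel X A)"
  proof (rule transI)
    fix x y z assume "(x, y) \<in> dgm_rel X A" "(y, z) \<in> dgm_rel X A"
    then obtain a b c d where m: "x \<in> cmsets X" "z \<in> cmsets X"
      and abcd: "a \<in> cmsets A" "b \<in> cmsets A" "c \<in> cmsets A" "d \<in> cmsets A"
      and e: "x +\<^sub>m a = y +\<^sub>m b" "y +\<^sub>m c = z +\<^sub>m d"
      by (auto simp: dgm_rel_def)
    have "x +\<^sub>m (a +\<^sub>m c) = z +\<^sub>m (b +\<^sub>m d)"
      by (metis e cmset_add_ac)
    with m abcd cmsets_add show "(x, z) \<in> dgm_rel X A"
      unfolding dgm_rel_def by blast
  qed
qed

lemma elts_fibre_ex:
  "\<exists>h. bij_betw h ({i. enat i < m} <+> {i. enat i < n}) {i. enat i < m + n}"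
proof (cases "finite ({i. enat i < m} <+> {i. enat i < n})")
  case True
  then obtain k l where mn: "m = enat k" "n = enat l"
    by (cases m; cases n) (auto simp: finite_Plus_iff)
  have "card ({..<k} <+> {..<l}) = card {..<k + l}"
    by (simp add: card_Plus)
  then show ?thesis
    unfolding mn plus_enat_simps enat_ord_simps lessThan_def[symmetric]
    by (intro finite_same_card_bij) auto
next
  case False
  then have inf: "infinite {i. enat i < m + n}"
    by (cases m; cases n) (auto simp: finite_Plus_iff)
  have "countable ({i. enat i < m} <+> {i. enat i < n})"
    by simp
  from countableE_infinite[OF this False] obtain f
    where f: "bij_betw f ({i. enat i < m} <+> {i. enat i < n}) (UNIV::nat set)" by blast
  have "countable {i. enat i < m + n}" by simp
  from countableE_infinite[OF this inf] obtain g
    where g: "bij_betw g {i. enat i < m + n} (UNIV::nat set)" by blast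
  from bij_betw_trans[OF f bij_betw_inv_into[OF g]] show ?thesis by blast
qed

lemma elts_add_bij:
  obtains h where "bij_betw h (elts \<sigma> <+> elts \<alpha>) (elts (\<sigma> +\<^sub>m \<alpha>))"
    "\<And>z. fst (h (Inl z)) = fst z" "\<And>z. fst (h (Inr z)) = fst z"
proof -
  have "\<forall>x. \<exists>h. bij_betw h ({i. enat i < \<sigma> x} <+> {i. enat i < \<alpha> x}) {i. enat i < \<sigma> x + \<alpha> x}"
    by (intro allI elts_fibre_ex)
  then have "\<exists>g. \<forall>x. bij_betw (g x) ({i. enat i < \<sigma> x} <+> {i. enat i < \<alpha> x})
      {i. enat i < \<sigma> x + \<alpha> x}"
    by (rule choice)
  then obtain g where g': "\<forall>x. bij_betw (g x) ({i. enat i < \<sigma> x} <+> {i. enat i < \<alpha> x})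
      {i. enat i < \<sigma> x + \<alpha> x}" ..
  note g = g'[rule_format]
  define h where "h = (\<lambda>s. case s of Inl (x, i) \<Rightarrow> (x, g x (Inl i)) | Inr (x, i) \<Rightarrow> (x, g x (Inr i)))"
  have inj: "inj_on h (elts \<sigma> <+> elts \<alpha>)"
  proof (rule inj_onI)
    fix s t assume st: "s \<in> elts \<sigma> <+> elts \<alpha>" "t \<in> elts \<sigma> <+> elts \<alpha>" "h s = h t"
    then obtain x u v where u: "s = map_sum (Pair x) (Pair x) u" "t = map_sum (Pair x) (Pair x) v"
      "g x u = g x v" "u \<in> {i. enat i < \<sigma> x} <+> {i. enat i < \<alpha> x}"
      "v \<in> {i. enat i < \<sigma> x} <+> {i. enat i < \<alpha> x}"
    proof -
      let ?u = "map_sum snd snd s" and ?v = "map_sum snd snd t" and ?x = "fst (h s)"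
      show thesis
        by (rule that[of ?x ?u ?v]; insert st; cases s; cases t)
           (auto simp: h_def elts_def split: prod.splits)
    qed
    then show "s = t" using bij_betw_imp_inj_on[OF g[of x]] by (auto dest: inj_onD)
  qed
  have im: "h ` (elts \<sigma> <+> elts \<alpha>) = elts (\<sigma> +\<^sub>m \<alpha>)"
  proof (intro equalityI subsetI)
    fix w assume "w \<in> h ` (elts \<sigma> <+> elts \<alpha>)"
    then obtain s where s: "s \<in> elts \<sigma> <+> elts \<alpha>" "w = h s" by (elim imageE)
    show "w \<in> elts (\<sigma> +\<^sub>m \<alpha>)"
    proof (cases s)
      case (Inl z)
      then show ?thesis using s bij_betwE[OF g[of "fst z"], rule_format, of "Inl (snd z)"]
        by (cases z) (auto simp: h_def elts_def cmset_add_def)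
    next
      case (Inr z)
      then show ?thesis using s bij_betwE[OF g[of "fst z"], rule_format, of "Inr (snd z)"]
        by (cases z) (auto simp: h_def elts_def cmset_add_def)
    qed
  next
    fix w assume "w \<in> elts (\<sigma> +\<^sub>m \<alpha>)"
    then obtain x j where w: "w = (x, j)" "j \<in> {i. enat i < \<sigma> x + \<alpha> x}"
      by (auto simp: elts_def cmset_add_def)
    from w(2) have "j \<in> g x ` ({i. enat i < \<sigma> x} <+> {i. enat i < \<alpha> x})"
      by (simp only: bij_betw_imp_surj_on[OF g[of x]])
    then obtain s where s: "s \<in> {i. enat i < \<sigma> x} <+> {i. enat i < \<alpha> x}" "g x s = j"
      by (elim imageE) simp
    then show "w \<in> h ` (elts \<sigma> <+> elts \<alpha>)"
    proof (cases s)
      case (Inl i)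
      then have "Inl (x, i) \<in> elts \<sigma> <+> elts \<alpha>" "h (Inl (x, i)) = w"
        using s w by (auto simp: elts_def h_def)
      then show ?thesis by (intro image_eqI[of w h]) simp_all
    next
      case (Inr i)
      then have "Inr (x, i) \<in> elts \<sigma> <+> elts \<alpha>" "h (Inr (x, i)) = w"
        using s w by (auto simp: elts_def h_def)
      then show ?thesis by (intro image_eqI[of w h]) simp_all
    qed
  qed
  show thesis
    by (rule that[of h]) (use inj im in \<open>auto simp: bij_betw_def h_def split: prod.splits\<close>)
qed

lemma lp_total_cong:
  assumes "\<And>i. i \<in> I \<Longrightarrow> f i = g i"
  shows "lp_total p f I = lp_total p g I"
  using assms by (simp add: lp_total_def cong: infsum_cong)

lemma lp_total_reindex:
  assumes "bij_betw h I J"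
  shows "lp_total p f J = lp_total p (\<lambda>i. f (h i)) I"
proof -
  have "(\<Sum>\<^sub>\<infinity>j\<in>J. ennreal (f j powr enn2real p)) = (\<Sum>\<^sub>\<infinity>i\<in>I. ennreal (f (h i) powr enn2real p))"
    using infsum_reindex_bij_betw[OF assms, of "\<lambda>j. ennreal (f j powr enn2real p)"] by simp
  moreover have "(SUP j\<in>J. ennreal (f j)) = (SUP i\<in>I. ennreal (f (h i)))"
    using assms by (auto simp: bij_betw_def image_image)
  ultimately show ?thesis by (simp add: lp_total_def)
qed

lemma lp_total_Plus_zero:
  assumes "\<And>y. y \<in> K \<Longrightarrow> f (Inr y) = 0"
  shows "lp_total p f (I <+> K) = lp_total p (\<lambda>i. f (Inl i)) I"
proof -
  have "(\<Sum>\<^sub>\<infinity>j\<in>I <+> K. ennreal (f j powr enn2real p))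
      = (\<Sum>\<^sub>\<infinity>j\<in>Inl ` I. ennreal (f j powr enn2real p))"
    by (rule infsum_cong_neutral) (use assms in auto)
  also have "\<dots> = (\<Sum>\<^sub>\<infinity>i\<in>I. ennreal (f (Inl i) powr enn2real p))"
    by (subst infsum_reindex) (auto simp: o_def)
  finally have 1: "(\<Sum>\<^sub>\<infinity>j\<in>I <+> K. ennreal (f j powr enn2real p))
      = (\<Sum>\<^sub>\<infinity>i\<in>I. ennreal (f (Inl i) powr enn2real p))" .
  have 2: "(SUP j\<in>I <+> K. ennreal (f j)) = (SUP i\<in>I. ennreal (f (Inl i)))"
  proof (rule antisym)
    show "(SUP j\<in>I <+> K. ennreal (f j)) \<le> (SUP i\<in>I. ennreal (f (Inl i)))"
      by (rule SUP_least) (use assms in \<open>auto intro: SUP_upper\<close>)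
    show "(SUP i\<in>I. ennreal (f (Inl i))) \<le> (SUP j\<in>I <+> K. ennreal (f j))"
      by (rule SUP_least) (auto intro: SUP_upper)
  qed
  show ?thesis using 1 2 by (simp add: lp_total_def)
qed

lemma matching_dist_add_le:
  "matching_dist p (\<sigma> +\<^sub>m \<alpha>) (\<tau> +\<^sub>m \<alpha>) \<le> matching_dist p \<sigma> \<tau>"
  unfolding matching_dist_def[of p \<sigma> \<tau>]
proof (rule INF_greatest)
  fix \<phi> assume "\<phi> \<in> {\<phi>. bij_betw \<phi> (elts \<sigma>) (elts \<tau>)}"
  then have \<phi>: "bij_betw \<phi> (elts \<sigma>) (elts \<tau>)" by simp
  obtain h where h: "bij_betw h (elts \<sigma> <+> elts \<alpha>) (elts (\<sigma> +\<^sub>m \<alpha>))"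
    "\<And>z. fst (h (Inl z)) = fst z" "\<And>z. fst (h (Inr z)) = fst z"
    using elts_add_bij by blast
  obtain k where k: "bij_betw k (elts \<tau> <+> elts \<alpha>) (elts (\<tau> +\<^sub>m \<alpha>))"
    "\<And>z. fst (k (Inl z)) = fst z" "\<And>z. fst (k (Inr z)) = fst z"
    using elts_add_bij by blast
  let ?S = "elts \<sigma> <+> elts \<alpha>"
  have m: "bij_betw (map_sum \<phi> id) ?S (elts \<tau> <+> elts \<alpha>)"
  proof (rule bij_betwI')
    show "(map_sum \<phi> id s = map_sum \<phi> id t) = (s = t)" if "s \<in> ?S" "t \<in> ?S" for s t
      using that bij_betw_imp_inj_on[OF \<phi>]
      by (cases s; cases t) (auto dest: inj_onD)
    show "map_sum \<phi> id s \<in> elts \<tau> <+> elts \<alpha>" if "s \<in> ?S" for s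
      using that bij_betwE[OF \<phi>] by (cases s) auto
    show "\<exists>s\<in>?S. t = map_sum \<phi> id s" if t: "t \<in> elts \<tau> <+> elts \<alpha>" for t
    proof (cases t)
      case (Inl y)
      with t have "y \<in> \<phi> ` elts \<sigma>"
        using bij_betw_imp_surj_on[OF \<phi>] by auto
      then obtain x where "x \<in> elts \<sigma>" "\<phi> x = y" by (metis imageE)
      then show ?thesis using Inl by (intro bexI[of _ "Inl x"]) auto
    next
      case (Inr y)
      then show ?thesis using t by (intro bexI[of _ "Inr y"]) auto
    qed
  qed
  define \<psi> where "\<psi> = k \<circ> map_sum \<phi> id \<circ> inv_into ?S h"
  have \<psi>: "bij_betw \<psi> (elts (\<sigma> +\<^sub>m \<alpha>)) (elts (\<tau> +\<^sub>m \<alpha>))"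
    unfolding \<psi>_def
    by (rule bij_betw_trans[OF bij_betw_inv_into[OF h(1)] bij_betw_trans[OF m k(1)]])
  have \<psi>h: "\<psi> (h s) = k (map_sum \<phi> id s)" if "s \<in> ?S" for s
    using that h(1) by (simp add: \<psi>_def bij_betw_def)
  have "matching_dist p (\<sigma> +\<^sub>m \<alpha>) (\<tau> +\<^sub>m \<alpha>)
      \<le> lp_total p (\<lambda>z. dist (fst z) (fst (\<psi> z))) (elts (\<sigma> +\<^sub>m \<alpha>))"
    unfolding matching_dist_def by (rule INF_lower) (use \<psi> in simp)
  also have "\<dots> = lp_total p (\<lambda>s. dist (fst (h s)) (fst (\<psi> (h s)))) ?S"
    by (rule lp_total_reindex[OF h(1)])
  also have "\<dots> = lp_total p (\<lambda>z. dist (fst (h (Inl z))) (fst (\<psi> (h (Inl z))))) (elts \<sigma>)"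
    by (rule lp_total_Plus_zero) (auto simp: \<psi>h[OF InrI] h k)
  also have "\<dots> = lp_total p (\<lambda>z. dist (fst z) (fst (\<phi> z))) (elts \<sigma>)"
    by (rule lp_total_cong) (simp add: \<psi>h[OF InlI] h k)
  finally show "matching_dist p (\<sigma> +\<^sub>m \<alpha>) (\<tau> +\<^sub>m \<alpha>)
      \<le> lp_total p (\<lambda>z. dist (fst z) (fst (\<phi> z))) (elts \<sigma>)" .
qed

lemma rep_dist_le:
  assumes "(\<sigma>, \<sigma>') \<in> dgm_rel X A" "(\<tau>, \<tau>') \<in> dgm_rel X A"
  shows "rep_dist p A \<sigma>' \<tau>' \<le> rep_dist p A \<sigma> \<tau>"
proof -
  obtain a b where ab: "a \<in> cmsets A" "b \<in> cmsets A" "\<sigma> +\<^sub>m a = \<sigma>' +\<^sub>m b"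
    using assms(1) by (auto simp: dgm_rel_def)
  obtain c d where cd: "c \<in> cmsets A" "d \<in> cmsets A" "\<tau> +\<^sub>m c = \<tau>' +\<^sub>m d"
    using assms(2) by (auto simp: dgm_rel_def)
  show ?thesis
    unfolding rep_dist_def[of p A \<sigma> \<tau>]
  proof (intro INF_greatest)
    fix \<alpha> \<beta> assume \<alpha>\<beta>: "\<alpha> \<in> cmsets A" "\<beta> \<in> cmsets A"
    have 1: "(\<sigma> +\<^sub>m \<alpha>) +\<^sub>m (a +\<^sub>m c) = \<sigma>' +\<^sub>m (b +\<^sub>m \<alpha> +\<^sub>m c)"
      by (metis ab(3) cmset_add_ac)
    have 2: "(\<tau> +\<^sub>m \<beta>) +\<^sub>m (a +\<^sub>m c) = \<tau>' +\<^sub>m (d +\<^sub>m \<beta> +\<^sub>m a)"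
      by (metis cd(3) cmset_add_ac)
    have mem: "b +\<^sub>m \<alpha> +\<^sub>m c \<in> cmsets A" "d +\<^sub>m \<beta> +\<^sub>m a \<in> cmsets A"
      using ab cd \<alpha>\<beta> by (simp_all add: cmsets_add)
    have "rep_dist p A \<sigma>' \<tau>'
        \<le> matching_dist p (\<sigma>' +\<^sub>m (b +\<^sub>m \<alpha> +\<^sub>m c)) (\<tau>' +\<^sub>m (d +\<^sub>m \<beta> +\<^sub>m a))"
      unfolding rep_dist_def
      by (rule INF_lower2[OF mem(1)], rule INF_lower[OF mem(2)])
    also have "\<dots> \<le> matching_dist p (\<sigma> +\<^sub>m \<alpha>) (\<tau> +\<^sub>m \<beta>)"
      unfolding 1[symmetric] 2[symmetric] by (rule matching_dist_add_le)
    finally show "rep_dist p A \<sigma>' \<tau>' \<le> matching_dist p (\<sigma> +\<^sub>m \<alpha>) (\<tau> +\<^sub>m \<beta>)" .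
  qed
qed

lemma dgm_dist_class:
  assumes "\<sigma> \<in> cmsets X" "\<tau> \<in> cmsets X"
  shows "dgm_dist p A (dgm_rel X A `` {\<sigma>}) (dgm_rel X A `` {\<tau>}) = rep_dist p A \<sigma> \<tau>"
proof (rule antisym)
  have self: "(\<sigma>, \<sigma>) \<in> dgm_rel X A" "(\<tau>, \<tau>) \<in> dgm_rel X A"
    using equiv_dgm_rel[of X A] assms by (auto simp: equiv_def refl_on_def)
  show "dgm_dist p A (dgm_rel X A `` {\<sigma>}) (dgm_rel X A `` {\<tau>}) \<le> rep_dist p A \<sigma> \<tau>"
    unfolding dgm_dist_def
    by (rule INF_lower2[of \<sigma>], use self in simp, rule INF_lower, use self in simp)
  have sym: "sym (dgm_rel X A)"
    using equiv_dgm_rel[of X A] by (simp add: equiv_def)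
  show "rep_dist p A \<sigma> \<tau> \<le> dgm_dist p A (dgm_rel X A `` {\<sigma>}) (dgm_rel X A `` {\<tau>})"
    unfolding dgm_dist_def
    by (intro INF_greatest rep_dist_le[where X = X]) (use sym in \<open>auto dest: symD\<close>)
qed

end

theory Submission
  imports Defs
begin

text \<open>
  The space of diagrams contains, at one fixed scale, arbitrarily large cubical grids of every
  dimension, and a Lebesgue covering argument shows that large \<open>n\<close>-dimensional grids defeat every
  cover of multiplicity at most \<open>n\<close>.

  To a lattice point \<open>x \<in> {0..P}\<^sup>n\<close> belongs the diagram of the \<open>n\<close> points
  \<open>(0, 3 P (i + 1) + x i)\<close>, \<open>i < n\<close>. The \<open>i\<close>-th point moves on a segment of length \<open>P\<close> of its own,
  and these segments lie at distance at least \<open>P\<close> from each other and from the diagonal. Moving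
  every coordinate by at most one costs at most \<open>n\<close>, whatever \<open>p\<close> and \<open>P\<close> are
  (\<open>rep_dist_image_le\<close>). Conversely, if \<open>x i = 0\<close> and \<open>y i = P\<close>, then the \<open>i\<close>-th point of the
  first diagram has no partner at distance less than \<open>P\<close>, and already this single point makes
  every matching cost at least \<open>P\<close> (\<open>rep_dist_ge\<close>).

  Given a cover of the diagrams by sets of diameter at most \<open>D\<close>, take \<open>P > D\<close> and colour each
  lattice point by a member of the cover containing its diagram. No colour meets two opposite faces
  of the cube, so Kuhn's combinatorial lemma, the engine of Brouwer's fixed point theorem, yields
  \<open>n + 1\<close> distinct colours in a single unit cube (\<open>grid_colouring_rainbow_cube\<close>). The members with
  these colours all meet one ball of radius \<open>n + 1\<close>. The radius does not depend on \<open>D\<close>, so the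
  asymptotic dimension is at least \<open>n\<close>, for every \<open>n\<close>.
\<close>

section \<open>Lebesgue covering for cubical grids\<close>

text \<open>
  Lattice points have infinitely many coordinates; in dimension \<open>n\<close>, only the faces in the first
  \<open>n\<close> directions matter. This keeps the dimension a variable and matches the vertices of Kuhn's simplices,
  whose coordinates from \<open>n\<close> on are constantly \<open>P\<close>.
\<close>

definition grid :: "nat \<Rightarrow> (nat \<Rightarrow> nat) set" where
  "grid P = {x. \<forall>i. x i \<le> P}"

text \<open>
  Label a vertex \<open>x\<close> in direction \<open>i\<close> by whether its colour reaches the face \<open>x i = P\<close>. Since no
  colour reaches both faces, this is a Kuhn labelling. The reduced label depends only on the colour,
  so the \<open>n + 1\<close> reduced labels of a completely labelled simplex come from \<open>n + 1\<close> colours.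
\<close>

lemma grid_colouring_rainbow_cube:
  fixes col :: "(nat \<Rightarrow> nat) \<Rightarrow> 'b"
  assumes "0 < P"
    and faces: "\<And>x y i. \<lbrakk>x \<in> grid P; y \<in> grid P; i < n; x i = 0; y i = P\<rbrakk> \<Longrightarrow> col x \<noteq> col y"
  obtains S b where "S \<subseteq> grid P" "\<forall>s\<in>S. \<forall>j. b j \<le> s j \<and> s j \<le> Suc (b j)"
    "finite S" "card (col ` S) \<ge> Suc n"
proof -
  define lab where
    "lab = (\<lambda>c i. if \<exists>y\<in>grid P. y i = P \<and> col y = c then 1 else 0 :: nat)"
  have "odd (card {s. ksimplex P n s \<and> (reduced n \<circ> (\<lambda>x. lab (col x))) ` s = {..n}})"
  proof (rule kuhn_combinatorial)
    show "\<forall>x j. (\<forall>j. x j \<le> P) \<and> j < n \<and> x j = 0 \<longrightarrow> lab (col x) j = 0"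
    proof (intro allI impI, elim conjE)
      fix x :: "nat \<Rightarrow> nat" and j assume x: "\<forall>j. x j \<le> P" "j < n" "x j = 0"
      then have "x \<in> grid P" by (simp add: grid_def)
      with faces x(2,3) have "\<not> (\<exists>y\<in>grid P. y j = P \<and> col y = col x)"
        by metis
      then show "lab (col x) j = 0" by (simp add: lab_def)
    qed
    show "\<forall>x j. (\<forall>j. x j \<le> P) \<and> j < n \<and> x j = P \<longrightarrow> lab (col x) j = 1"
    proof (intro allI impI, elim conjE)
      fix x :: "nat \<Rightarrow> nat" and j assume x: "\<forall>j. x j \<le> P" "x j = P"
      then have "x \<in> grid P" by (simp add: grid_def)
      with x(2) have "\<exists>y\<in>grid P. y j = P \<and> col y = col x" by blast
      then show "lab (col x) j = 1" by (simp add: lab_def)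
    qed
  qed fact
  then have "{s. ksimplex P n s \<and> (reduced n \<circ> (\<lambda>x. lab (col x))) ` s = {..n}} \<noteq> {}"
    by (rule odd_card_imp_not_empty)
  then obtain S b u where S: "kuhn_simplex P n b u S"
    and full: "(reduced n \<circ> (\<lambda>x. lab (col x))) ` S = {..n}"
    by (auto elim: ksimplex.cases)
  interpret kuhn_simplex P n b u S by fact
  have fin: "finite S"
    by (simp add: s_eq)
  have "card ((reduced n \<circ> lab) ` (col ` S)) \<le> card (col ` S)"
    using fin by (intro card_image_le finite_imageI)
  moreover have "(reduced n \<circ> lab) ` (col ` S) = {..n}"
    using full by (simp add: image_comp o_def)
  ultimately have colours: "Suc n \<le> card (col ` S)"
    by simp
  have "S \<subseteq> grid P"
    unfolding grid_def by (intro subsetI CollectI allI) (rule s_le_p)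
  moreover have "\<forall>s\<in>S. \<forall>j. b j \<le> s j \<and> s j \<le> Suc (b j)"
    by (intro ballI allI conjI) (erule base_le, erule le_Suc_base)
  ultimately show thesis
    using fin colours by (rule that)
qed

text \<open>
  The number \<open>R\<close> bounds the image of every unit cube and must serve for all \<open>D\<close>, while the size of
  the grid may grow with \<open>D\<close>.
\<close>

lemma not_asdim_at_most_if_grids:
  fixes d :: "'b \<Rightarrow> 'b \<Rightarrow> ennreal" and R :: real
  assumes "R > 0"
    and grids: "\<And>D::real. \<exists>P>0. \<exists>f. (\<forall>x\<in>grid P. f x \<in> M) \<and>
      (\<forall>x\<in>grid P. \<forall>y\<in>grid P.
         (\<forall>j. x j \<le> Suc (y j) \<and> y j \<le> Suc (x j)) \<longrightarrow> d (f x) (f y) < ennreal R) \<and>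
      (\<forall>x\<in>grid P. \<forall>y\<in>grid P. \<forall>i\<le>m. x i = 0 \<and> y i = P \<longrightarrow> d (f x) (f y) > ennreal D)"
  shows "\<not> asdim_at_most M d m"
proof
  assume "asdim_at_most M d m"
  from this[unfolded asdim_at_most_def, rule_format, OF \<open>R > 0\<close>] obtain \<U> D
    where cover: "\<Union>\<U> = M"
    and diam: "\<forall>U\<in>\<U>. \<forall>x\<in>U. \<forall>y\<in>U. d x y \<le> ennreal D"
    and mult: "\<forall>x\<in>M. finite {U\<in>\<U>. U \<inter> {y\<in>M. d x y < ennreal R} \<noteq> {}} \<and>
                    card {U\<in>\<U>. U \<inter> {y\<in>M. d x y < ennreal R} \<noteq> {}} \<le> m + 1"
    by (elim exE conjE)
  from grids[of D] obtain P f where "P > 0" and fM: "\<forall>x\<in>grid P. f x \<in> M"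
    and near: "\<forall>x\<in>grid P. \<forall>y\<in>grid P.
         (\<forall>j. x j \<le> Suc (y j) \<and> y j \<le> Suc (x j)) \<longrightarrow> d (f x) (f y) < ennreal R"
    and far: "\<forall>x\<in>grid P. \<forall>y\<in>grid P. \<forall>i\<le>m. x i = 0 \<and> y i = P
         \<longrightarrow> d (f x) (f y) > ennreal D"
    by (elim exE conjE)
  have "\<forall>x\<in>grid P. \<exists>U\<in>\<U>. f x \<in> U"
    using fM cover by blast
  then have "\<exists>col. \<forall>x\<in>grid P. col x \<in> \<U> \<and> f x \<in> col x"
    by (intro bchoice) blast
  then obtain col where col: "\<forall>x\<in>grid P. col x \<in> \<U> \<and> f x \<in> col x" ..
  have faces: "col x \<noteq> col y"
    if "x \<in> grid P" "y \<in> grid P" "i < Suc m" "x i = 0" "y i = P" for x y i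
  proof
    assume "col x = col y"
    with bspec[OF col that(1)] bspec[OF col that(2)] have "d (f x) (f y) \<le> ennreal D"
      by (intro diam[rule_format, of "col y"]) simp_all
    moreover have "ennreal D < d (f x) (f y)"
      using far[rule_format, of x y i] that by simp
    ultimately show False by simp
  qed
  obtain S b where S: "S \<subseteq> grid P" "\<forall>s\<in>S. \<forall>j. b j \<le> s j \<and> s j \<le> Suc (b j)" "finite S"
    and card: "card (col ` S) \<ge> Suc (Suc m)"
    by (rule grid_colouring_rainbow_cube[where n = "Suc m" and col = col, OF \<open>P > 0\<close> faces])
  from card obtain c where c: "c \<in> S"
    by (cases "S = {}") auto
  let ?B = "{y\<in>M. d (f c) y < ennreal R}"
  have "col ` S \<subseteq> {U\<in>\<U>. U \<inter> ?B \<noteq> {}}"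
  proof
    fix U assume "U \<in> col ` S"
    then obtain s where s: "s \<in> S" "U = col s" by blast
    then have grid: "c \<in> grid P" "s \<in> grid P"
      using S(1) c by auto
    have "c j \<le> Suc (s j) \<and> s j \<le> Suc (c j)" for j
      using S(2)[rule_format, OF c, of j] S(2)[rule_format, OF s(1), of j] by linarith
    then have "d (f c) (f s) < ennreal R"
      using near[rule_format, OF grid] by simp
    then have "f s \<in> U \<inter> ?B" "U \<in> \<U>"
      using s(2) bspec[OF col grid(2)] bspec[OF fM grid(2)] by simp_all
    then show "U \<in> {U\<in>\<U>. U \<inter> ?B \<noteq> {}}"
      by (intro CollectI conjI) auto
  qed
  moreover have "f c \<in> M"
    using fM S(1) c by auto
  note mult_c = bspec[OF mult this]
  ultimately have "card (col ` S) \<le> card {U\<in>\<U>. U \<inter> ?B \<noteq> {}}"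
    by (intro card_mono conjunct1[OF mult_c])
  also note conjunct2[OF mult_c]
  finally have "card (col ` S) \<le> m + 1" .
  with card show False by simp
qed


section \<open>Bounds for matching distances\<close>

lemma ennpowr_mono: "x \<le> y \<Longrightarrow> 0 \<le> r \<Longrightarrow> ennpowr x r \<le> ennpowr y r"
  by (auto simp: ennpowr_def top_unique less_top intro!: ennreal_leI powr_mono2 enn2real_mono)

lemma ennpowr_ennreal: "0 \<le> a \<Longrightarrow> ennpowr (ennreal a) r = ennreal (a powr r)"
  by (simp add: ennpowr_def)

lemma enn2real_ge_1: "1 \<le> p \<Longrightarrow> p \<noteq> \<infinity> \<Longrightarrow> 1 \<le> enn2real p"
  by (cases p rule: ennreal_cases) (auto simp: ennreal_ge_1)

lemma lp_total_ge:
  assumes "1 \<le> p" "i \<in> I" "0 \<le> f i"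
  shows "ennreal (f i) \<le> lp_total p f I"
proof (cases "p = \<infinity>")
  case True
  then show ?thesis using assms by (auto simp: lp_total_def intro: SUP_upper)
next
  case False
  define q where "q = enn2real p"
  have q: "1 \<le> q" using enn2real_ge_1 False assms by (simp add: q_def)
  have "ennreal (f i powr q) = (\<Sum>\<^sub>\<infinity>j\<in>{i}. ennreal (f j powr q))"
    by simp
  also have "\<dots> \<le> (\<Sum>\<^sub>\<infinity>j\<in>I. ennreal (f j powr q))"
    using assms by (intro infsum_mono_neutral nonneg_summable_on_complete) auto
  finally have "ennpowr (ennreal (f i powr q)) (1 / q)
      \<le> ennpowr (\<Sum>\<^sub>\<infinity>j\<in>I. ennreal (f j powr q)) (1 / q)"
    using q by (intro ennpowr_mono) auto
  moreover have "ennpowr (ennreal (f i powr q)) (1 / q) = ennreal (f i)"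
    using q assms by (simp add: ennpowr_ennreal powr_powr)
  ultimately show ?thesis
    using False by (simp add: lp_total_def q_def)
qed

text \<open>
  The factor \<open>card I\<close> is not optimal for \<open>p > 1\<close>, but it is the same for all \<open>p\<close>.
\<close>

lemma lp_total_le:
  fixes C :: real
  assumes "1 \<le> p" "finite I" "\<And>i. i \<in> I \<Longrightarrow> 0 \<le> f i \<and> f i \<le> C" "0 \<le> C"
  shows "lp_total p f I \<le> ennreal (card I * C)"
proof (cases "I = {}")
  case True
  then show ?thesis by (simp add: lp_total_def ennpowr_def bot_ennreal)
next
  case False
  then have n: "1 \<le> real (card I)"
    using assms(2) by (simp add: Suc_leI card_gt_0_iff)
  show ?thesis
  proof (cases "p = \<infinity>")
    case True
    have "f i \<le> card I * C" if "i \<in> I" for i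
      using assms(3)[OF that] mult_right_mono[OF n assms(4)] by simp
    then show ?thesis using True
      by (auto simp: lp_total_def intro!: SUP_least ennreal_leI)
  next
    case False
    define q where "q = enn2real p"
    have q: "1 \<le> q" using enn2real_ge_1 False assms by (simp add: q_def)
    have "(\<Sum>\<^sub>\<infinity>j\<in>I. ennreal (f j powr q)) = ennreal (\<Sum>j\<in>I. f j powr q)"
      using assms by simp
    also have "\<dots> \<le> ennreal (card I * C powr q)"
      using assms q by (intro ennreal_leI sum_bounded_above powr_mono2) auto
    finally have "ennpowr (\<Sum>\<^sub>\<infinity>j\<in>I. ennreal (f j powr q)) (1 / q)
        \<le> ennpowr (ennreal (card I * C powr q)) (1 / q)"
      using q by (intro ennpowr_mono) auto
    also have "\<dots> = ennreal (card I powr (1 / q) * C)"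
      using q assms by (simp add: ennpowr_ennreal powr_mult powr_powr)
    also have "\<dots> \<le> ennreal (card I * C)"
    proof (intro ennreal_leI mult_right_mono assms)
      show "real (card I) powr (1 / q) \<le> real (card I)"
        using powr_mono[of "1 / q" 1 "card I"] q n by simp
    qed
    finally show ?thesis
      using False by (simp add: lp_total_def q_def)
  qed
qed

text \<open>
  The extra points of \<open>A\<close> on either side leave \<open>z\<close> in place, and its partner is a point of \<open>\<tau>\<close> or
  of \<open>A\<close>. For every \<open>p\<close>, a single term bounds the total from below.
\<close>

lemma rep_dist_ge:
  fixes \<sigma> \<tau> :: "'a::metric_space \<Rightarrow> enat"
  assumes "1 \<le> p" "\<sigma> z \<noteq> 0" "\<And>w. \<tau> w \<noteq> 0 \<or> w \<in> A \<Longrightarrow> c \<le> dist z w"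
  shows "ennreal c \<le> rep_dist p A \<sigma> \<tau>"
  unfolding rep_dist_def matching_dist_def
proof (intro INF_greatest, clarify)
  fix \<alpha> \<beta> \<phi>
  assume \<beta>: "\<beta> \<in> cmsets A" and \<phi>: "bij_betw \<phi> (elts (\<sigma> +\<^sub>m \<alpha>)) (elts (\<tau> +\<^sub>m \<beta>))"
  have z: "(z, 0) \<in> elts (\<sigma> +\<^sub>m \<alpha>)"
    using assms(2) by (simp add: elts_def cmset_add_def zero_enat_def[symmetric])
  then have "\<phi> (z, 0) \<in> elts (\<tau> +\<^sub>m \<beta>)"
    using \<phi> by (auto dest: bij_betwE)
  then have "(\<tau> +\<^sub>m \<beta>) (fst (\<phi> (z, 0))) \<noteq> 0"
    by (auto simp: elts_def)
  then have "c \<le> dist z (fst (\<phi> (z, 0)))"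
    using assms(3) \<beta> by (auto simp: cmset_add_def cmsets_def)
  also have "ennreal \<dots> \<le> lp_total p (\<lambda>z. dist (fst z) (fst (\<phi> z))) (elts (\<sigma> +\<^sub>m \<alpha>))"
    using lp_total_ge[OF assms(1) z, of "\<lambda>z. dist (fst z) (fst (\<phi> z))"] by simp
  finally show "ennreal c \<le> lp_total p (\<lambda>z. dist (fst z) (fst (\<phi> z))) (elts (\<sigma> +\<^sub>m \<alpha>))"
    by (simp add: ennreal_leI)
qed

definition cmset_of_set :: "'a set \<Rightarrow> 'a \<Rightarrow> enat" where
  "cmset_of_set S = (\<lambda>z. if z \<in> S then 1 else 0)"

lemma cmset_of_set_in_cmsets: "countable S \<Longrightarrow> S \<subseteq> Y \<Longrightarrow> cmset_of_set S \<in> cmsets Y"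
  by (auto simp: cmset_of_set_def cmsets_def)

lemma bij_betw_elts_cmset_of_set:
  assumes "inj_on u I"
  shows "bij_betw (\<lambda>i. (u i, 0)) I (elts (cmset_of_set (u ` I)))"
  using assms
  by (auto simp: bij_betw_def inj_on_def elts_def cmset_of_set_def one_enat_def split: if_splits)

lemma matching_dist_image_le:
  fixes u v :: "'i \<Rightarrow> 'a::metric_space" and C :: real
  assumes "1 \<le> p" "finite I" "inj_on u I" "inj_on v I" "0 \<le> C"
    and close: "\<And>i. i \<in> I \<Longrightarrow> dist (u i) (v i) \<le> C"
  shows "matching_dist p (cmset_of_set (u ` I)) (cmset_of_set (v ` I)) \<le> ennreal (card I * C)"
proof -
  let ?U = "elts (cmset_of_set (u ` I))" and ?V = "elts (cmset_of_set (v ` I))"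
  let ?h = "\<lambda>i. (u i, 0::nat)" and ?k = "\<lambda>i. (v i, 0::nat)"
  define \<phi> where "\<phi> = ?k \<circ> inv_into I ?h"
  have h: "bij_betw ?h I ?U" and k: "bij_betw ?k I ?V"
    using assms by (simp_all add: bij_betw_elts_cmset_of_set)
  have "bij_betw \<phi> ?U ?V"
    unfolding \<phi>_def by (rule bij_betw_trans[OF bij_betw_inv_into[OF h] k])
  then have "matching_dist p (cmset_of_set (u ` I)) (cmset_of_set (v ` I))
      \<le> lp_total p (\<lambda>z. dist (fst z) (fst (\<phi> z))) ?U"
    unfolding matching_dist_def by (intro INF_lower) simp
  also have "\<dots> = lp_total p (\<lambda>i. dist (fst (?h i)) (fst (\<phi> (?h i)))) I"
    by (rule lp_total_reindex[OF h])
  also have "\<dots> = lp_total p (\<lambda>i. dist (u i) (v i)) I"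
    by (rule lp_total_cong) (simp add: \<phi>_def inv_into_f_f[OF bij_betw_imp_inj_on[OF h]])
  also have "\<dots> \<le> ennreal (card I * C)"
    using assms by (intro lp_total_le) auto
  finally show ?thesis .
qed

lemma rep_dist_le_matching_dist:
  assumes "\<beta> \<in> cmsets A"
  shows "rep_dist p A \<sigma> \<tau> \<le> matching_dist p \<sigma> (\<tau> +\<^sub>m \<beta>)"
proof -
  have "\<sigma> +\<^sub>m empty_cmset = \<sigma>"
    by (simp add: cmset_add_def empty_cmset_def)
  then show ?thesis
    unfolding rep_dist_def
    by (intro INF_lower2[OF empty_cmset_in] INF_lower2[OF assms]) simp
qed

lemma rep_dist_image_le:
  fixes u v :: "'i \<Rightarrow> 'a::metric_space" and C :: real
  assumes "1 \<le> p" "finite I" "inj_on u I" "inj_on v I" "0 \<le> C"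
    and "\<And>i. i \<in> I \<Longrightarrow> dist (u i) (v i) \<le> C"
  shows "rep_dist p A (cmset_of_set (u ` I)) (cmset_of_set (v ` I)) \<le> ennreal (card I * C)"
proof -
  have "cmset_of_set (v ` I) +\<^sub>m empty_cmset = cmset_of_set (v ` I)"
    by (simp add: cmset_add_def empty_cmset_def)
  with rep_dist_le_matching_dist[OF empty_cmset_in] matching_dist_image_le[OF assms]
  show ?thesis by (metis order_trans)
qed

text \<open>
  The points \<open>v i\<close> of \<open>A\<close> may be added to the empty diagram to serve as partners.
\<close>

lemma rep_dist_image_empty_le:
  fixes u v :: "'i \<Rightarrow> 'a::metric_space" and C :: real
  assumes "1 \<le> p" "finite I" "inj_on u I" "inj_on v I" "v ` I \<subseteq> A" "0 \<le> C"
    and "\<And>i. i \<in> I \<Longrightarrow> dist (u i) (v i) \<le> C"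
  shows "rep_dist p A (cmset_of_set (u ` I)) empty_cmset \<le> ennreal (card I * C)"
proof -
  have "cmset_of_set (v ` I) \<in> cmsets A"
    using assms by (intro cmset_of_set_in_cmsets) (auto intro: countable_finite)
  moreover have "empty_cmset +\<^sub>m cmset_of_set (v ` I) = cmset_of_set (v ` I)"
    by (simp add: cmset_add_def empty_cmset_def)
  ultimately have "rep_dist p A (cmset_of_set (u ` I)) empty_cmset
      \<le> matching_dist p (cmset_of_set (u ` I)) (cmset_of_set (v ` I))"
    by (metis rep_dist_le_matching_dist)
  also have "\<dots> \<le> ennreal (card I * C)"
    using assms by (intro matching_dist_image_le)
  finally show ?thesis .
qed


section \<open>Grids of diagrams\<close>

text \<open>
  The factor 3 spaces the segments out: consecutive ones, of length \<open>P\<close>, start \<open>3 P\<close> apart, and the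
  lowest one starts at height \<open>3 P\<close>, more than \<open>P\<close> away from the diagonal.
\<close>

definition grid_point :: "nat \<Rightarrow> (nat \<Rightarrow> nat) \<Rightarrow> nat \<Rightarrow> real \<times> real" where
  "grid_point P x i = (0, real (3 * P * (i + 1) + x i))"

definition grid_cmset :: "nat \<Rightarrow> nat \<Rightarrow> (nat \<Rightarrow> nat) \<Rightarrow> real \<times> real \<Rightarrow> enat" where
  "grid_cmset n P x = cmset_of_set (grid_point P x ` {..<n})"

lemma dist_grid_point_eq:
  "dist (grid_point P x i) (grid_point Q y j)
    = \<bar>real (3 * P * (i + 1) + x i) - real (3 * Q * (j + 1) + y j)\<bar>"
  by (simp add: grid_point_def dist_prod_def dist_real_def)

lemma dist_grid_point_same: "dist (grid_point P x i) (grid_point P y i) = \<bar>real (x i) - real (y i)\<bar>"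
  by (simp add: dist_grid_point_eq)

lemma dist_grid_point_distinct:
  assumes "x \<in> grid P" "y \<in> grid P" "i \<noteq> j"
  shows "real P \<le> dist (grid_point P x i) (grid_point P y j)"
proof -
  have gap: "3 * P * (k + 1) + a + P \<le> 3 * P * (l + 1) + b"
    if "k < l" "a \<le> P" for k l a b :: nat
  proof -
    have "3 * P * (k + 1) + 3 * P \<le> 3 * P * (l + 1)"
      using mult_le_mono2[of "k + 2" "l + 1" "3 * P"] that by (simp add: algebra_simps)
    then show ?thesis using that by linarith
  qed
  have bounds: "x i \<le> P" "y j \<le> P"
    using assms by (auto simp: grid_def)
  from \<open>i \<noteq> j\<close> consider "i < j" | "j < i" by linarith
  then show ?thesis
  proof cases
    case 1
    from gap[OF this bounds(1), of "y j"] show ?thesis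
      unfolding dist_grid_point_eq by linarith
  next
    case 2
    from gap[OF this bounds(2), of "x i"] show ?thesis
      unfolding dist_grid_point_eq by linarith
  qed
qed

lemma dist_grid_point_diagonal:
  assumes "w \<in> diagonal"
  shows "real P \<le> dist (grid_point P x i) w"
proof -
  obtain t where w: "w = (t, t)"
    using assms by (auto simp: diagonal_def)
  let ?c = "real (3 * P * (i + 1) + x i)"
  \<comment> \<open>The two coordinate distances add up to at least \<open>?c\<close>, so one of them is at least half of it.\<close>
  have "\<bar>t\<bar> \<le> dist (grid_point P x i) w" "\<bar>?c - t\<bar> \<le> dist (grid_point P x i) w"
    using dist_fst_le[of "grid_point P x i" w] dist_snd_le[of "grid_point P x i" w]
    by (simp_all add: w grid_point_def dist_real_def)
  moreover have "3 * P * 1 \<le> 3 * P * (i + 1)"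
    by (intro mult_le_mono2) simp
  then have "3 * real P \<le> ?c"
    by linarith
  ultimately show ?thesis by linarith
qed

lemma inj_grid_point: "0 < P \<Longrightarrow> x \<in> grid P \<Longrightarrow> inj_on (grid_point P x) I"
  using dist_grid_point_distinct[of x P x] by (force simp: inj_on_def)

lemma rep_dist_grid_near:
  assumes "1 \<le> p" "0 < P" "x \<in> grid P" "y \<in> grid P"
    and close: "\<And>j. x j \<le> Suc (y j) \<and> y j \<le> Suc (x j)"
  shows "rep_dist p diagonal (grid_cmset n P x) (grid_cmset n P y) \<le> ennreal (real n)"
proof -
  have "dist (grid_point P x i) (grid_point P y i) \<le> 1" for i
    using close[of i] unfolding dist_grid_point_same by linarith
  then show ?thesis
    using rep_dist_image_le[of p "{..<n}" "grid_point P x" "grid_point P y" 1] assms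
    by (simp add: grid_cmset_def inj_grid_point)
qed

lemma rep_dist_grid_far:
  assumes "1 \<le> p" "x \<in> grid P" "y \<in> grid P" "i < n" "x i = 0" "y i = P"
  shows "ennreal (real P) \<le> rep_dist p diagonal (grid_cmset n P x) (grid_cmset n P y)"
proof (rule rep_dist_ge)
  show "grid_cmset n P x (grid_point P x i) \<noteq> 0"
    using assms by (simp add: grid_cmset_def cmset_of_set_def)
  fix w assume "grid_cmset n P y w \<noteq> 0 \<or> w \<in> diagonal"
  then consider j where "w = grid_point P y j" | "w \<in> diagonal"
    by (auto simp: grid_cmset_def cmset_of_set_def split: if_splits)
  then show "real P \<le> dist (grid_point P x i) w"
  proof cases
    case (1 j)
    then show ?thesis
      using dist_grid_point_distinct[of x P y i j] dist_grid_point_same[of P x i y] assms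
      by (cases "i = j") auto
  next
    case 2
    then show ?thesis by (rule dist_grid_point_diagonal)
  qed
qed fact

lemma grid_cmset_in_cmsets: "grid_cmset n P x \<in> cmsets UNIV"
  unfolding grid_cmset_def by (intro cmset_of_set_in_cmsets) auto

lemma grid_dgm_in_dgm_space:
  assumes "1 \<le> p" "0 < P" "x \<in> grid P"
  shows "dgm_rel UNIV diagonal `` {grid_cmset n P x} \<in> dgm_space p UNIV diagonal"
proof -
  \<comment> \<open>Any \<open>n\<close> distinct points of the diagonal would do, since only finiteness is claimed.\<close>
  let ?v = "\<lambda>i::nat. (real i, real i)"
  define C where "C = (\<Sum>i<n. dist (grid_point P x i) (?v i))"
  have "dist (grid_point P x i) (?v i) \<le> C" if "i < n" for i
    unfolding C_def using that by (intro member_le_sum) auto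
  moreover have "0 \<le> C"
    unfolding C_def by (intro sum_nonneg) simp
  moreover have "inj_on ?v {..<n}" "?v ` {..<n} \<subseteq> diagonal"
    by (auto simp: inj_on_def diagonal_def)
  ultimately have "rep_dist p diagonal (grid_cmset n P x) empty_cmset
      \<le> ennreal (card {..<n} * C)"
    unfolding grid_cmset_def using assms
    by (intro rep_dist_image_empty_le[where v = ?v]) (simp_all add: inj_grid_point)
  also have "\<dots> < \<infinity>" by simp
  finally show ?thesis
    by (simp add: dgm_space_def diagrams_def empty_dgm_def quotientI grid_cmset_in_cmsets
        dgm_dist_class empty_cmset_in)
qed

theorem corollary6:
  fixes p :: ennreal
  assumes "1 \<le> p"
  shows "asdim (dgm_space p UNIV diagonal) (dgm_dist p diagonal) = \<infinity>"
proof -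
  have "\<not> asdim_at_most (dgm_space p UNIV diagonal) (dgm_dist p diagonal) m" for m
  proof (rule not_asdim_at_most_if_grids)
    show "0 < real (Suc m) + 1" by simp
    fix D :: real
    obtain P :: nat where P: "max D 0 < real P"
      using reals_Archimedean2 by blast
    then have pos: "0 < P" by simp
    let ?f = "\<lambda>x. dgm_rel UNIV diagonal `` {grid_cmset (Suc m) P x}"
    have dist: "dgm_dist p diagonal (?f x) (?f y)
        = rep_dist p diagonal (grid_cmset (Suc m) P x) (grid_cmset (Suc m) P y)" for x y
      by (simp add: dgm_dist_class grid_cmset_in_cmsets)
    have near: "dgm_dist p diagonal (?f x) (?f y) < ennreal (real (Suc m) + 1)"
      if "x \<in> grid P" "y \<in> grid P" "\<forall>j. x j \<le> Suc (y j) \<and> y j \<le> Suc (x j)" for x y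
    proof -
      have "dgm_dist p diagonal (?f x) (?f y) \<le> ennreal (real (Suc m))"
        unfolding dist using that by (intro rep_dist_grid_near assms pos) auto
      also have "\<dots> < ennreal (real (Suc m) + 1)"
        by (intro ennreal_lessI) auto
      finally show ?thesis .
    qed
    have far: "ennreal D < dgm_dist p diagonal (?f x) (?f y)"
      if "x \<in> grid P" "y \<in> grid P" "i \<le> m" "x i = 0" "y i = P" for x y i
    proof -
      have "ennreal D < ennreal (real P)"
        using P by (intro ennreal_lessI) auto
      also have "\<dots> \<le> dgm_dist p diagonal (?f x) (?f y)"
        unfolding dist using that by (intro rep_dist_grid_far[of _ _ _ _ i] assms) auto
      finally show ?thesis .
    qed
    show "\<exists>P>0. \<exists>f. (\<forall>x\<in>grid P. f x \<in> dgm_space p UNIV diagonal) \<and>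
      (\<forall>x\<in>grid P. \<forall>y\<in>grid P. (\<forall>j. x j \<le> Suc (y j) \<and> y j \<le> Suc (x j)) \<longrightarrow>
         dgm_dist p diagonal (f x) (f y) < ennreal (real (Suc m) + 1)) \<and>
      (\<forall>x\<in>grid P. \<forall>y\<in>grid P. \<forall>i\<le>m. x i = 0 \<and> y i = P \<longrightarrow>
         ennreal D < dgm_dist p diagonal (f x) (f y))"
      using pos near far grid_dgm_in_dgm_space[OF assms pos]
      by (intro exI[of _ P] conjI exI[of _ ?f]) auto
  qed
  then show ?thesis
    by (simp add: asdim_def top_enat_def[symmetric])
qed

end
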